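(* If $R$ is an exact commutative ring then every non-zero element of $R$ is a zero divisor or a unit.
   Context: Rings are associative with unity $1$. $R^{m\times n}$ is the set of $m\times n$ matrices over $R$. For $A\in R^{m\times n}$, $\operatorname{Row}(A)=\{uA: u\in R^{1\times m}\}\subseteq R^{1\times n}$ and $\operatorname{Col}(A)=\{Av: v\in R^{n\times 1}\}\subseteq R^{m\times 1}$. $R$ is exact if for all positive integers $m,n$ and all $A\in R^{m\times n}$: (E1) if $x\in R^{1\times n}\setminus\operatorname{Row}(A)$ then there are $v,v'\in R^{n\times 1}$ with $Av=Av'$ but $xv\neq xv'$; and (E2) if $y\in R^{m\times 1}\setminus\operatorname{Col}(A)$ then there are $u,u'\in R^{1\times m}$ with $uA=u'A$ but $uy\neq u'y$. A zero divisor is an element $a\in R$ with $ab=0$ for some non-zero $b\in R$. *)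

theory Defs
  imports Main "Jordan_Normal_Form.Matrix"
begin

text \<open>The sort \<open>{ring, monoid_mult}\<close> is that of associative rings with unity; unlike
  \<open>ring_1\<close> it does not exclude the zero ring. Row and column vectors are
  \<open>1 \<times> n\<close> and \<open>n \<times> 1\<close> matrices.\<close>

definition Row :: "'a :: {ring, monoid_mult} mat \<Rightarrow> 'a mat set" where
  "Row A = {u * A | u. u \<in> carrier_mat 1 (dim_row A)}"

definition Col :: "'a :: {ring, monoid_mult} mat \<Rightarrow> 'a mat set" where
  "Col A = {A * v | v. v \<in> carrier_mat (dim_col A) 1}"

definition exact_ring :: "'a :: {ring, monoid_mult} itself \<Rightarrow> bool" where
  "exact_ring (_ :: 'a itself) \<longleftrightarrow>
    (\<forall>m > 0. \<forall>n > 0. \<forall>A \<in> (carrier_mat m n :: 'a mat set).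
      (\<forall>x \<in> carrier_mat 1 n - Row A.
        \<exists>v \<in> carrier_mat n 1. \<exists>v' \<in> carrier_mat n 1. A * v = A * v' \<and> x * v \<noteq> x * v') \<and>
      (\<forall>y \<in> carrier_mat m 1 - Col A.
        \<exists>u \<in> carrier_mat 1 m. \<exists>u' \<in> carrier_mat 1 m. u * A = u' * A \<and> u * y \<noteq> u' * y))"

text \<open>In a ring with more than one element, \<open>0\<close> counts as a zero divisor.\<close>

definition zero_divisor :: "'a :: {ring, monoid_mult} \<Rightarrow> bool" where
  "zero_divisor a \<longleftrightarrow> (\<exists>b. b \<noteq> 0 \<and> a * b = 0)"

end

theory Submission
  imports Defs
begin

text \<open>The argument applies the row half of exactness (a row vector outside \<open>Row A\<close> is separated
  from it by two column vectors that \<open>A\<close> does not distinguish) to the \<open>1 \<times> 1\<close> matrix with entry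
  \<open>a\<close> and the vector with entry \<open>1\<close>. That vector lies in the row space exactly when \<open>a\<close> is a
  unit. If it does not, exactness yields scalars \<open>p \<noteq> q\<close> with \<open>a * p = a * q\<close>, so \<open>p - q\<close> is a
  non-zero element that \<open>a\<close> annihilates.\<close>

lemma mult_mat_1_1_index:
  fixes A B :: "'a :: semiring_0 mat"
  assumes "A \<in> carrier_mat 1 1" "B \<in> carrier_mat 1 1"
  shows "(A * B) $$ (0, 0) = A $$ (0, 0) * B $$ (0, 0)"
  using assms by (simp add: scalar_prod_def)

theorem proposition4p2:
  fixes a :: "'a :: {comm_ring, comm_monoid_mult}"
  assumes "exact_ring TYPE('a)"
    and "a \<noteq> 0"
  shows "zero_divisor a \<or> a dvd 1"
proof (cases "a dvd 1")
  case False
  define A where "A = mat 1 1 (\<lambda>_. a)"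
  define x where "x = mat 1 1 (\<lambda>_. 1 :: 'a)"
  have A: "A \<in> carrier_mat 1 1" "A $$ (0, 0) = a"
    and x: "x \<in> carrier_mat 1 1" "x $$ (0, 0) = 1"
    by (simp_all add: A_def x_def)
  have "x \<notin> Row A"
  proof
    assume "x \<in> Row A"
    then obtain u where u: "u \<in> carrier_mat 1 1" "x = u * A"
      using A(1) by (auto simp: Row_def)
    have "1 = a * u $$ (0, 0)"
      using mult_mat_1_1_index[OF u(1) A(1)] u(2) x(2) A(2) by (simp add: mult.commute)
    with False show False by (auto simp only: dvd_def)
  qed
  with x(1) have xdiff: "x \<in> carrier_mat 1 1 - Row A" by blast
  have "\<forall>x \<in> carrier_mat 1 1 - Row A.
    \<exists>v \<in> carrier_mat 1 1. \<exists>v' \<in> carrier_mat 1 1. A * v = A * v' \<and> x * v \<noteq> x * v'"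
  proof -
    have one: "(1 :: nat) > 0" by simp
    from assms(1)[unfolded exact_ring_def, THEN spec, THEN mp, OF one, THEN spec, THEN mp, OF one,
        THEN bspec, OF A(1)]
    show ?thesis by (rule conjunct1)
  qed
  from bspec[OF this xdiff] obtain v v' where
    v: "v \<in> carrier_mat 1 1" and v': "v' \<in> carrier_mat 1 1"
    and eq: "A * v = A * v'" and neq: "x * v \<noteq> x * v'"
    by (elim bexE conjE)
  have "v $$ (0, 0) \<noteq> v' $$ (0, 0)"
  proof
    assume "v $$ (0, 0) = v' $$ (0, 0)"
    with v v' have "v = v'" by (intro eq_matI) auto
    with neq show False by simp
  qed
  moreover have "a * v $$ (0, 0) = a * v' $$ (0, 0)"
    using mult_mat_1_1_index[OF A(1) v] mult_mat_1_1_index[OF A(1) v'] eq A(2) by simp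
  ultimately have "v $$ (0, 0) - v' $$ (0, 0) \<noteq> 0" "a * (v $$ (0, 0) - v' $$ (0, 0)) = 0"
    by (simp_all add: right_diff_distrib)
  then show ?thesis unfolding zero_divisor_def by blast
qed simp

end
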